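(* Let $f\colon\mathbb{N}\to\mathbb{R}^+$ and let $\{\lambda^m\}_{m=1}^\infty$ be a sequence of partitions. Then the sequence $$\left\{\frac{V_{\lambda^m}(d_f)}{E_{\lambda^m}(d_f)^2}\right\}_{m}$$ is bounded if and only if for all $m$ $$ n\sum_{i=1}^{n-1}f(i)^2\le c\,(n-\lambda^m_1)\left(\sum_{i=1}^{n-1}f(i)\right)^2,$$ where $n:=|\lambda^m|$ and $c$ is a constant independent of $m$.
   Context: $\mathbb{R}^+$ denotes the positive reals. A partition $\lambda=(\lambda_1,\dots,\lambda_k)$ of $n=|\lambda|$ is a non-increasing sequence of positive integers with sum $n$; $\lambda^m_1$ denotes the first (largest) part of $\lambda^m$. A partition is identified with its Ferrers diagram, which has $\lambda_j$ cells in row $j$ (rows numbered from the top downwards). A standard Young tableau of shape $\lambda$ is a filling of the diagram with the numbers $1,\dots,n$, each used exactly once, such that every row (left to right) and every column (top to bottom) is increasing. A standard Young tableau $T$ has a descent at $i$ if the entry $i+1$ lies strictly south (and weakly west) of the entry $i$ in $T$; $D(T)$ is the set of all descents of $T$. The descent function of $f$ is $d_f(T):=\sum_{i\in D(T)}f(i)$. $E_\lambda(d_f)$ and $V_\lambda(d_f)$ are the expectation and the variance of $d_f$ under the uniform distribution on the standard Young tableaux of shape $\lambda$. *)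

theory Defs
  imports "HOL-Probability.Probability"
begin

definition is_partition :: "nat list \<Rightarrow> bool" where
  "is_partition p \<longleftrightarrow> sorted_wrt (\<ge>) p \<and> (\<forall>k\<in>set p. k > 0)"

(* Cells are pairs (row, column), both counted from 0, rows downwards (south) and
   columns to the right (east). *)
definition diagram :: "nat list \<Rightarrow> (nat \<times> nat) set" where
  "diagram p = {(r, c). r < length p \<and> c < p ! r}"

(* Extensionality makes tableaux that agree on the diagram equal, so that the set of
   tableaux of a given shape is finite and each one is counted once. *)
definition SYT :: "nat list \<Rightarrow> (nat \<times> nat \<Rightarrow> nat) set" where
  "SYT p = {T \<in> extensional (diagram p).
     bij_betw T (diagram p) {1..sum_list p} \<and>
     (\<forall>r c c'. (r, c) \<in> diagram p \<and> (r, c') \<in> diagram p \<and> c < c' \<longrightarrow> T (r, c) < T (r, c')) \<and>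
     (\<forall>r r' c. (r, c) \<in> diagram p \<and> (r', c) \<in> diagram p \<and> r < r' \<longrightarrow> T (r, c) < T (r', c))}"

definition descents :: "nat list \<Rightarrow> (nat \<times> nat \<Rightarrow> nat) \<Rightarrow> nat set" where
  "descents p T = {i. \<exists>r c r' c'. (r, c) \<in> diagram p \<and> (r', c') \<in> diagram p \<and>
     T (r, c) = i \<and> T (r', c') = i + 1 \<and> r < r' \<and> c' \<le> c}"

definition descent_fun :: "(nat \<Rightarrow> real) \<Rightarrow> nat list \<Rightarrow> (nat \<times> nat \<Rightarrow> nat) \<Rightarrow> real" where
  "descent_fun f p T = (\<Sum>i\<in>descents p T. f i)"

definition E_desc :: "nat list \<Rightarrow> (nat \<Rightarrow> real) \<Rightarrow> real" where
  "E_desc p f = measure_pmf.expectation (pmf_of_set (SYT p)) (descent_fun f p)"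

definition V_desc :: "nat list \<Rightarrow> (nat \<Rightarrow> real) \<Rightarrow> real" where
  "V_desc p f = measure_pmf.variance (pmf_of_set (SYT p)) (descent_fun f p)"

lemma finite_diagram: "finite (diagram p)"
proof -
  have "diagram p = (SIGMA r:{..<length p}. {..<p ! r})"
    by (auto simp: diagram_def)
  then show ?thesis by simp
qed

(* pmf_of_set is unspecified on infinite or empty sets; the next two facts rule this out. *)
lemma finite_SYT: "finite (SYT p)"
proof (rule finite_subset)
  show "SYT p \<subseteq> diagram p \<rightarrow>\<^sub>E {1..sum_list p}"
    by (auto simp: SYT_def PiE_def dest: bij_betw_apply)
  show "finite (diagram p \<rightarrow>\<^sub>E {1..sum_list p})"
    by (intro finite_PiE finite_diagram) auto
qed

lemma SYT_nonempty: "SYT p \<noteq> {}"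
proof -
  define S where "S r = sum_list (take r p)" for r
  define U where "U = (\<lambda>(r, c). S r + c + 1)"
  have S_Suc: "S (Suc r) = S r + p ! r" if "r < length p" for r
    using that by (simp add: S_def take_Suc_conv_app_nth)
  have S_mono: "S r \<le> S r'" if "r \<le> r'" for r r'
  proof -
    have "take r' p = take r p @ take (r' - r) (drop r p)"
      using that by (metis le_add_diff_inverse take_add)
    then show ?thesis by (simp add: S_def)
  qed
  have lt: "S r + c < S r'" if "(r, c) \<in> diagram p" "r < r'" for r c r'
  proof -
    have "S r + c < S (Suc r)" using that S_Suc by (auto simp: diagram_def)
    also have "\<dots> \<le> S r'" using that by (intro S_mono) simp
    finally show ?thesis .
  qed
  have inj: "inj_on U (diagram p)"
  proof (rule inj_onI, clarify)
    fix r c r' c'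
    assume a: "(r, c) \<in> diagram p" "(r', c') \<in> diagram p" "U (r, c) = U (r', c')"
    have "\<not> r < r'" "\<not> r' < r" using a lt[of r c r'] lt[of r' c' r] by (auto simp: U_def)
    then show "r = r' \<and> c = c'" using a by (auto simp: U_def)
  qed
  have sub: "U ` diagram p \<subseteq> {1..sum_list p}"
  proof clarify
    fix r c assume a: "(r, c) \<in> diagram p"
    then have "S r + c < S (length p)" by (intro lt) (auto simp: diagram_def)
    then show "U (r, c) \<in> {1..sum_list p}" by (auto simp: U_def S_def)
  qed
  have "diagram p = (SIGMA r:{..<length p}. {..<p ! r})"
    by (auto simp: diagram_def)
  then have "card (diagram p) = sum_list p"
    by (simp add: sum_list_sum_nth atLeast0LessThan)
  then have bij: "bij_betw U (diagram p) {1..sum_list p}"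
    using inj sub card_image[OF inj] by (simp add: bij_betw_def card_subset_eq)
  have "restrict U (diagram p) \<in> SYT p"
    using bij by (auto simp: SYT_def U_def dest: add_lessD1[OF lt])
  then show ?thesis by blast
qed

end

theory Submission
  imports Defs
begin

text \<open>
  Write \<open>n\<close> for the size of the partition, \<open>k\<close> for the number of its cells outside the first
  row, \<open>F\<close> for the sum of the weights \<open>f i\<close> with \<open>i < n\<close> and \<open>Q\<close> for the sum of their squares.
  The moments of the descent function are governed by the probabilities that a uniformly random
  standard tableau has a descent at \<open>i\<close>, or descents at both \<open>i\<close> and \<open>j\<close>. Up to constant factors,
  the former is \<open>k / n\<close> and the latter, at distance at least 2, is at most \<open>(k / n)\<^sup>2\<close>.

  Equidistribution (\<open>num_desc_single\<close>, \<open>num_desc_pair\<close>): an elementary dual Knuth move exchanges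
  a descent at \<open>i\<close> with one at \<open>i + 1\<close> and leaves all descents outside \<open>{i - 1..i + 2}\<close> alone.
  Hence the probability \<open>P\<close> of a descent at \<open>i\<close> is the same for all \<open>i\<close>, and the probability \<open>q\<close>
  of descents at \<open>i\<close> and \<open>j\<close> is the same for all pairs at distance at least 2.

  Order of magnitude: the entry following a descent lies below the first row, so a tableau has at
  most \<open>k\<close> descents. Averaging the number of descents and its square over all positions gives
  \<open>P \<le> k / (n - 1)\<close> (\<open>num_desc_upper\<close>) and, unless \<open>n\<close> is small,
  \<open>q\<close> at most a constant times \<open>(k / n)\<^sup>2\<close> (\<open>num_desc_13_upper\<close>).
  For the lower bound, exchanging \<open>i\<close> and \<open>i + 1\<close> shows that the content (column minus row) of the
  cell of \<open>i + 1\<close> exceeds that of the cell of \<open>i\<close> by \<open>1 - 2 P\<close> on average. The average total of all contents is therefore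
  \<open>(1 - 2 P) n (n - 1) / 2\<close>; as this total depends on the shape alone, \<open>P\<close> is determined by the
  contents of the diagram (\<open>content_sum_formula\<close>), and bounding these gives
  \<open>P \<ge> k / (2 (n - 1))\<close> (\<open>num_desc_lower\<close>). Together, \<open>q \<le> 10 P\<^sup>2\<close> (\<open>num_desc_pair_le\<close>).

  Conclusion (\<open>variance_ratio_bounds\<close>): the expectation is \<open>P F\<close>. The second moment is at least its
  diagonal part \<open>P Q\<close>; its part near the diagonal is at most \<open>3 P Q\<close>, and the remainder
  is at most \<open>q F\<^sup>2 \<le> 10 (P F)\<^sup>2\<close>. So the ratio of the variance to the squared expectation is, up to
  additive and multiplicative constants, \<open>P Q / (P F)\<^sup>2 = Q / (P F\<^sup>2)\<close>, and this is \<open>n Q / (k F\<^sup>2)\<close>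
  up to a constant factor.
\<close>

section \<open>Tableaux through the cells of their entries\<close>

definition cell_of :: "nat list \<Rightarrow> (nat \<times> nat \<Rightarrow> nat) \<Rightarrow> nat \<Rightarrow> nat \<times> nat" where
  "cell_of p T = the_inv_into (diagram p) T"

abbreviation row_of :: "nat list \<Rightarrow> (nat \<times> nat \<Rightarrow> nat) \<Rightarrow> nat \<Rightarrow> nat" where
  "row_of p T k \<equiv> fst (cell_of p T k)"

abbreviation col_of :: "nat list \<Rightarrow> (nat \<times> nat \<Rightarrow> nat) \<Rightarrow> nat \<Rightarrow> nat" where
  "col_of p T k \<equiv> snd (cell_of p T k)"

lemma SYT_bij: "T \<in> SYT p \<Longrightarrow> bij_betw T (diagram p) {1..sum_list p}"
  by (simp add: SYT_def)

lemma SYT_range: "T \<in> SYT p \<Longrightarrow> x \<in> diagram p \<Longrightarrow> T x \<in> {1..sum_list p}"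
  by (rule bij_betw_apply[OF SYT_bij])

lemma cell_of_in_diagram:
  assumes "T \<in> SYT p" "k \<in> {1..sum_list p}"
  shows "cell_of p T k \<in> diagram p"
  using bij_betw_apply[OF bij_betw_the_inv_into[OF SYT_bij[OF assms(1)]] assms(2)]
  by (simp only: cell_of_def)

lemma entry_cell_of:
  assumes "T \<in> SYT p" "k \<in> {1..sum_list p}"
  shows "T (cell_of p T k) = k"
  unfolding cell_of_def by (rule f_the_inv_into_f_bij_betw[OF SYT_bij[OF assms(1)]]) (rule assms(2))

lemma cell_of_entry:
  assumes "T \<in> SYT p" "x \<in> diagram p"
  shows "cell_of p T (T x) = x"
  unfolding cell_of_def
  by (rule the_inv_into_f_f[OF bij_betw_imp_inj_on[OF SYT_bij[OF assms(1)]] assms(2)])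

lemma SYT_rows:
  assumes "T \<in> SYT p" "(r, c) \<in> diagram p" "(r, c') \<in> diagram p" "c < c'"
  shows "T (r, c) < T (r, c')"
proof -
  have "\<forall>r c c'. (r, c) \<in> diagram p \<and> (r, c') \<in> diagram p \<and> c < c' \<longrightarrow> T (r, c) < T (r, c')"
    using assms(1) by (simp add: SYT_def)
  then show ?thesis using assms(2-4) by blast
qed

lemma SYT_columns:
  assumes "T \<in> SYT p" "(r, c) \<in> diagram p" "(r', c) \<in> diagram p" "r < r'"
  shows "T (r, c) < T (r', c)"
proof -
  have "\<forall>r r' c. (r, c) \<in> diagram p \<and> (r', c) \<in> diagram p \<and> r < r' \<longrightarrow> T (r, c) < T (r', c)"
    using assms(1) by (simp add: SYT_def)
  then show ?thesis using assms(2-4) by blast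
qed

lemma diagram_down_closed:
  assumes p: "is_partition p" and x: "x \<in> diagram p" and le: "fst y \<le> fst x" "snd y \<le> snd x"
  shows "y \<in> diagram p"
proof -
  have "p ! fst x \<le> p ! fst y"
    using p x le by (cases "fst y = fst x")
      (auto simp: is_partition_def diagram_def sorted_wrt_iff_nth_less)
  then show ?thesis using x le by (auto simp: diagram_def)
qed

lemma SYT_strict_mono:
  assumes p: "is_partition p" and T: "T \<in> SYT p" and y: "y \<in> diagram p"
    and le: "fst x \<le> fst y" "snd x \<le> snd y" and ne: "x \<noteq> y"
  shows "T x < T y"
proof -
  obtain r c r' c' where xy: "x = (r, c)" "y = (r', c')"
    by (cases x, cases y) blast
  have d: "(r, c) \<in> diagram p" "(r, c') \<in> diagram p" "(r', c') \<in> diagram p"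
    using diagram_down_closed[OF p y] y le xy by auto
  have row: "T (r, c) < T (r, c')" if "c < c'" by (rule SYT_rows[OF T d(1,2) that])
  have col: "T (r, c') < T (r', c')" if "r < r'" by (rule SYT_columns[OF T d(2,3) that])
  show ?thesis
  proof (cases "c < c'")
    case True
    then show ?thesis using row col xy le by (cases "r < r'") auto
  next
    case False
    then show ?thesis using col xy le ne by auto
  qed
qed

text \<open>
  Of two consecutive entries, the second one lies either south and weakly west or weakly north and
  east of the first: otherwise a third cell would hold an entry between the two, or the order would
  be reversed. Descents can therefore be read off from the rows alone.
\<close>

lemma descent_col_le:
  assumes p: "is_partition p" and T: "T \<in> SYT p" and i: "1 \<le> i" "i < sum_list p"
    and r: "row_of p T i < row_of p T (Suc i)"
  shows "col_of p T (Suc i) \<le> col_of p T i"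
proof (rule ccontr)
  assume c: "\<not> ?thesis"
  let ?z = "(row_of p T i, col_of p T (Suc i))"
  have x: "cell_of p T (Suc i) \<in> diagram p"
    using cell_of_in_diagram[OF T, of "Suc i"] i by simp
  have z: "?z \<in> diagram p" using diagram_down_closed[OF p x] r by simp
  have "T ?z < T (cell_of p T (Suc i))"
    using r by (intro SYT_strict_mono[OF p T x]) (auto simp: prod_eq_iff)
  moreover have "T (cell_of p T i) < T ?z"
    using c by (intro SYT_strict_mono[OF p T z]) (auto simp: prod_eq_iff)
  ultimately show False using entry_cell_of[OF T] i by simp
qed

lemma nondescent_col_less:
  assumes p: "is_partition p" and T: "T \<in> SYT p" and i: "1 \<le> i" "i < sum_list p"
    and r: "row_of p T (Suc i) \<le> row_of p T i"
  shows "col_of p T i < col_of p T (Suc i)"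
proof (rule ccontr)
  assume c: "\<not> ?thesis"
  have x: "cell_of p T i \<in> diagram p"
    using cell_of_in_diagram[OF T, of i] i by simp
  have e: "T (cell_of p T i) = i" "T (cell_of p T (Suc i)) = Suc i"
    using entry_cell_of[OF T] i by simp_all
  then have "cell_of p T (Suc i) \<noteq> cell_of p T i" by (metis n_not_Suc_n)
  then have "T (cell_of p T (Suc i)) < T (cell_of p T i)"
    using SYT_strict_mono[OF p T x r] c by simp
  then show False using e by simp
qed

lemma mem_descents_iff:
  assumes p: "is_partition p" and T: "T \<in> SYT p"
  shows "i \<in> descents p T \<longleftrightarrow> 1 \<le> i \<and> i < sum_list p \<and> row_of p T i < row_of p T (Suc i)"
proof
  assume "i \<in> descents p T"
  then obtain r c r' c' where d: "(r, c) \<in> diagram p" "(r', c') \<in> diagram p"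
    "T (r, c) = i" "T (r', c') = Suc i" "r < r'"
    unfolding descents_def mem_Collect_eq Suc_eq_plus1 by blast
  then have "cell_of p T i = (r, c)" "cell_of p T (Suc i) = (r', c')"
    using cell_of_entry[OF T d(1)] cell_of_entry[OF T d(2)] by simp_all
  then show "1 \<le> i \<and> i < sum_list p \<and> row_of p T i < row_of p T (Suc i)"
    using SYT_range[OF T d(1)] SYT_range[OF T d(2)] d by simp
next
  assume a: "1 \<le> i \<and> i < sum_list p \<and> row_of p T i < row_of p T (Suc i)"
  obtain r c r' c' where e: "cell_of p T i = (r, c)" "cell_of p T (Suc i) = (r', c')"
    by (cases "cell_of p T i", cases "cell_of p T (Suc i)") blast
  have "(r, c) \<in> diagram p" "T (r, c) = i"
    using a cell_of_in_diagram[OF T, of i] entry_cell_of[OF T, of i] unfolding e by simp_all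
  moreover have "(r', c') \<in> diagram p" "T (r', c') = i + 1"
    using a cell_of_in_diagram[OF T, of "Suc i"] entry_cell_of[OF T, of "Suc i"]
    unfolding e by simp_all
  moreover have "r < r'" "c' \<le> c"
    using a descent_col_le[OF p T, of i] unfolding e by simp_all
  ultimately have "(r, c) \<in> diagram p \<and> (r', c') \<in> diagram p \<and> T (r, c) = i \<and>
      T (r', c') = i + 1 \<and> r < r' \<and> c' \<le> c" by blast
  then show "i \<in> descents p T" unfolding descents_def by (intro CollectI exI)
qed

lemma descents_subset:
  assumes "is_partition p" "T \<in> SYT p"
  shows "descents p T \<subseteq> {1..<sum_list p}"
  by (auto simp: mem_descents_iff[OF assms])

section \<open>Swapping consecutive entries\<close>

definition swap_entries :: "nat list \<Rightarrow> nat \<Rightarrow> (nat \<times> nat \<Rightarrow> nat) \<Rightarrow> nat \<times> nat \<Rightarrow> nat" where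
  "swap_entries p k T = restrict (\<lambda>x. Transposition.transpose k (Suc k) (T x)) (diagram p)"

definition swappable :: "nat list \<Rightarrow> nat \<Rightarrow> (nat \<times> nat \<Rightarrow> nat) \<Rightarrow> bool" where
  "swappable p k T \<longleftrightarrow> row_of p T k \<noteq> row_of p T (Suc k) \<and> col_of p T k \<noteq> col_of p T (Suc k)"

text \<open>
  The numbers \<open>k\<close> and \<open>k + 1\<close> compare in the same way with every other entry, so exchanging them
  can only break the order of the two themselves, and this order is not constrained if their cells
  share neither a row nor a column.
\<close>

lemma swap_entries_SYT:
  assumes T: "T \<in> SYT p" and k: "1 \<le> k" "k < sum_list p" and sw: "swappable p k T"
  shows "swap_entries p k T \<in> SYT p"
proof -
  let ?t = "Transposition.transpose k (Suc k)"
  have "bij_betw ?t {1..sum_list p} {1..sum_list p}"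
    using k by simp
  from bij_betw_trans[OF SYT_bij[OF T] this]
  have bij: "bij_betw (swap_entries p k T) (diagram p) {1..sum_list p}"
    by (subst bij_betw_cong[where g = "?t \<circ> T"]) (simp_all add: swap_entries_def)
  have order: "?t (T x) < ?t (T y)"
    if "T x < T y" "x \<in> diagram p" "y \<in> diagram p" "fst x = fst y \<or> snd x = snd y" for x y
  proof -
    have "\<not> (T x = k \<and> T y = Suc k)"
    proof
      assume "T x = k \<and> T y = Suc k"
      then have "cell_of p T k = x" "cell_of p T (Suc k) = y"
        using cell_of_entry[OF T that(2)] cell_of_entry[OF T that(3)] by simp_all
      then show False using sw that(4) by (simp add: swappable_def)
    qed
    then show ?thesis using that(1) by (auto simp: Transposition.transpose_def)
  qed
  have rows: "swap_entries p k T (r, c) < swap_entries p k T (r, c')"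
    if "(r, c) \<in> diagram p" "(r, c') \<in> diagram p" "c < c'" for r c c'
    using order[OF SYT_rows[OF T that] that(1,2)] that by (simp add: swap_entries_def)
  have columns: "swap_entries p k T (r, c) < swap_entries p k T (r', c)"
    if "(r, c) \<in> diagram p" "(r', c) \<in> diagram p" "r < r'" for r r' c
    using order[OF SYT_columns[OF T that] that(1,2)] that by (simp add: swap_entries_def)
  have ext: "swap_entries p k T \<in> extensional (diagram p)" by (simp add: swap_entries_def)
  show ?thesis unfolding SYT_def mem_Collect_eq
    by (intro conjI ext bij allI impI; elim conjE; intro rows columns)
qed

lemma cell_of_swap_entries:
  assumes T: "T \<in> SYT p" and k: "1 \<le> k" "k < sum_list p" and sw: "swappable p k T"
    and j: "j \<in> {1..sum_list p}"
  shows "cell_of p (swap_entries p k T) j = cell_of p T (Transposition.transpose k (Suc k) j)"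
proof -
  let ?t = "Transposition.transpose k (Suc k)"
  have t: "?t j \<in> {1..sum_list p}" using j k by (auto simp: Transposition.transpose_def)
  have "swap_entries p k T (cell_of p T (?t j)) = j"
    using cell_of_in_diagram[OF T t] entry_cell_of[OF T t] by (simp add: swap_entries_def)
  then show ?thesis
    using cell_of_entry[OF swap_entries_SYT[OF T k sw] cell_of_in_diagram[OF T t]] by simp
qed

lemma swap_entries_twice: "T \<in> SYT p \<Longrightarrow> swap_entries p k (swap_entries p k T) = T"
  by (rule ext) (auto simp: swap_entries_def SYT_def extensional_def)

lemma swappable_swap_entries:
  assumes "T \<in> SYT p" "1 \<le> k" "k < sum_list p" "swappable p k T"
  shows "swappable p k (swap_entries p k T)"
  using assms cell_of_swap_entries[OF assms] by (auto simp: swappable_def)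

section \<open>Equidistribution of descents\<close>

text \<open>
  The elementary dual Knuth relation. Read the tableau row by row from the bottom to the top. If
  exactly one of \<open>i\<close> and \<open>i + 1\<close> is a descent, then \<open>i + 1\<close> is not the middle one of \<open>i\<close>, \<open>i + 1\<close>,
  \<open>i + 2\<close> in the reading word. The move exchanges \<open>i + 1\<close> with \<open>i + 2\<close> if \<open>i\<close> is in the middle, and
  with \<open>i\<close> if \<open>i + 2\<close> is in the middle; the condition on rows tells these two cases apart.
\<close>

definition dual_knuth :: "nat list \<Rightarrow> nat \<Rightarrow> (nat \<times> nat \<Rightarrow> nat) \<Rightarrow> nat \<times> nat \<Rightarrow> nat" where
  "dual_knuth p i T =
     (if (row_of p T i < row_of p T (i + 2)) = (row_of p T i < row_of p T (Suc i))
      then swap_entries p i T else swap_entries p (Suc i) T)"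

lemma dual_knuth:
  assumes p: "is_partition p" and T: "T \<in> SYT p" and i: "1 \<le> i" "Suc i < sum_list p"
    and one: "(i \<in> descents p T) \<noteq> (Suc i \<in> descents p T)"
  shows "dual_knuth p i T \<in> SYT p"
    and "dual_knuth p i (dual_knuth p i T) = T"
    and "i \<in> descents p (dual_knuth p i T) \<longleftrightarrow> Suc i \<in> descents p T"
    and "Suc i \<in> descents p (dual_knuth p i T) \<longleftrightarrow> i \<in> descents p T"
    and "j \<notin> {i-1..i+2} \<Longrightarrow> j \<in> descents p (dual_knuth p i T) \<longleftrightarrow> j \<in> descents p T"
proof -
  let ?a = "row_of p T i" and ?b = "row_of p T (Suc i)" and ?c = "row_of p T (i + 2)"
  let ?x = "col_of p T i" and ?y = "col_of p T (Suc i)" and ?z = "col_of p T (i + 2)"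
  have one': "(?a < ?b) \<noteq> (?b < ?c)"
    using one i by (simp add: mem_descents_iff[OF p T])
  let ?A = "cell_of p T i" and ?B = "cell_of p T (Suc i)" and ?C = "cell_of p T (i + 2)"
  have C: "?C \<in> diagram p" using cell_of_in_diagram[OF T, of "i + 2"] i by simp
  have ent: "T ?A = i" "T ?B = Suc i" "T ?C = i + 2"
    using entry_cell_of[OF T, of i] entry_cell_of[OF T, of "Suc i"]
      entry_cell_of[OF T, of "i + 2"] i by simp_all
  have xy: "?b \<le> ?a \<Longrightarrow> ?x < ?y" using nondescent_col_less[OF p T, of i] i by simp
  have yz: "?c \<le> ?b \<Longrightarrow> ?y < ?z" using nondescent_col_less[OF p T, of "Suc i"] i by simp
  have middle: "z = ?B" if "z \<in> diagram p" "T ?A < T z" "T z < T ?C" for z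
  proof -
    have "T z = Suc i" using that ent by simp
    then show ?thesis using cell_of_entry[OF T that(1)] by simp
  qed
  \<comment> \<open>When \<open>i + 2\<close> lies below \<open>i\<close>, a common column of the two entries to be exchanged would place
      \<open>i + 2\<close> east of \<open>i\<close>. One of the two remaining corners of the rectangle spanned by the cells
      of \<open>i\<close> and \<open>i + 2\<close> would then hold \<open>i + 1\<close>, which lies elsewhere.\<close>
  have col1: "?x \<noteq> ?y" if "?a < ?c" "?a < ?b"
  proof
    assume eq: "?x = ?y"
    have less: "?x < ?z" using eq yz that one' by simp
    have z: "(?a, ?z) \<in> diagram p" using diagram_down_closed[OF p C] that by simp
    have "T ?A < T (?a, ?z)"
      using less by (intro SYT_strict_mono[OF p T z]) (auto simp: prod_eq_iff)
    moreover have "T (?a, ?z) < T ?C"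
      using that by (intro SYT_strict_mono[OF p T C]) (auto simp: prod_eq_iff)
    ultimately have "(?a, ?z) = ?B" by (rule middle[OF z])
    then show False using that by (simp add: prod_eq_iff)
  qed
  have col2: "?y \<noteq> ?z" if "?a < ?c" "?b \<le> ?a"
  proof
    assume eq: "?y = ?z"
    have less: "?x < ?z" using eq xy that by simp
    have z: "(?c, ?x) \<in> diagram p" using diagram_down_closed[OF p C] less by simp
    have "T ?A < T (?c, ?x)"
      using that by (intro SYT_strict_mono[OF p T z]) (auto simp: prod_eq_iff)
    moreover have "T (?c, ?x) < T ?C"
      using less by (intro SYT_strict_mono[OF p T C]) (auto simp: prod_eq_iff)
    ultimately have "(?c, ?x) = ?B" by (rule middle[OF z])
    then show False using that by (simp add: prod_eq_iff)
  qed
  define l where "l = (if (?a < ?c) = (?a < ?b) then i else Suc i)"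
  have dk: "dual_knuth p i T = swap_entries p l T" by (simp add: dual_knuth_def l_def)
  have l: "1 \<le> l" "l < sum_list p" using i by (auto simp: l_def)
  have sw: "swappable p l T"
    using one' xy yz col1 col2 by (auto simp: swappable_def l_def split: if_splits)
  show S: "dual_knuth p i T \<in> SYT p" unfolding dk by (rule swap_entries_SYT[OF T l sw])
  have cell: "cell_of p (dual_knuth p i T) j = cell_of p T (Transposition.transpose l (Suc l) j)"
    if "j \<in> {1..sum_list p}" for j
    unfolding dk using cell_of_swap_entries[OF T l sw that] .
  have rows: "row_of p (dual_knuth p i T) i = (if l = i then ?b else ?a)"
    "row_of p (dual_knuth p i T) (Suc i) = (if l = i then ?a else ?c)"
    "row_of p (dual_knuth p i T) (i + 2) = (if l = i then ?c else ?b)"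
    using cell[of i] cell[of "Suc i"] cell[of "i + 2"] i
    by (auto simp: l_def Transposition.transpose_def)
  show "i \<in> descents p (dual_knuth p i T) \<longleftrightarrow> Suc i \<in> descents p T"
    and "Suc i \<in> descents p (dual_knuth p i T) \<longleftrightarrow> i \<in> descents p T"
    using rows one' i by (auto simp: mem_descents_iff[OF p S] mem_descents_iff[OF p T] l_def split: if_splits)
  show "j \<in> descents p (dual_knuth p i T) \<longleftrightarrow> j \<in> descents p T" if "j \<notin> {i-1..i+2}"
  proof (cases "1 \<le> j \<and> j < sum_list p")
    case True
    have "cell_of p (dual_knuth p i T) j = cell_of p T j"
      "cell_of p (dual_knuth p i T) (Suc j) = cell_of p T (Suc j)"
      using cell[of j] cell[of "Suc j"] True that
      by (auto simp: l_def Transposition.transpose_def split: if_splits)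
    then show ?thesis by (simp add: mem_descents_iff[OF p S] mem_descents_iff[OF p T])
  qed (auto simp: mem_descents_iff[OF p S] mem_descents_iff[OF p T])
  have "dual_knuth p i (dual_knuth p i T) = swap_entries p l (dual_knuth p i T)"
    using rows one' unfolding dual_knuth_def[of p i "dual_knuth p i T"]
    by (auto simp: l_def split: if_splits)
  then show "dual_knuth p i (dual_knuth p i T) = T"
    using swap_entries_twice[OF T] dk by simp
qed

definition num_desc :: "nat list \<Rightarrow> nat set \<Rightarrow> nat" where
  "num_desc p S = card {T \<in> SYT p. S \<subseteq> descents p T}"

text \<open>
  The move is a bijection from the tableaux with a descent at \<open>i\<close> and none at \<open>i + 1\<close> to those with
  the opposite pattern, and it does not change which elements of \<open>S\<close> are descents.
\<close>

lemma num_desc_shift: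
  assumes p: "is_partition p" and i: "1 \<le> i" "Suc i < sum_list p"
    and S: "S \<inter> {i-1..i+2} = {}"
  shows "num_desc p (insert i S) = num_desc p (insert (Suc i) S)"
proof -
  define X where "X = {T \<in> SYT p. S \<subseteq> descents p T \<and> i \<in> descents p T \<and> Suc i \<notin> descents p T}"
  define Y where "Y = {T \<in> SYT p. S \<subseteq> descents p T \<and> i \<notin> descents p T \<and> Suc i \<in> descents p T}"
  define Z where "Z = {T \<in> SYT p. S \<subseteq> descents p T \<and> i \<in> descents p T \<and> Suc i \<in> descents p T}"
  have S_pres: "S \<subseteq> descents p (dual_knuth p i T) \<longleftrightarrow> S \<subseteq> descents p T"
    if "T \<in> SYT p" "(i \<in> descents p T) \<noteq> (Suc i \<in> descents p T)" for T
    using dual_knuth(5)[OF p that(1) i that(2)] S by blast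
  have "bij_betw (dual_knuth p i) X Y"
    using S_pres dual_knuth(1-4)[OF p _ i] unfolding X_def Y_def
    by (intro bij_betw_byWitness[where f' = "dual_knuth p i"]) auto
  then have "card X = card Y" by (rule bij_betw_same_card)
  moreover have "finite X" "finite Y" "finite Z"
    using finite_SYT by (auto simp: X_def Y_def Z_def)
  moreover have "{T \<in> SYT p. insert i S \<subseteq> descents p T} = X \<union> Z"
    "{T \<in> SYT p. insert (Suc i) S \<subseteq> descents p T} = Y \<union> Z"
    "X \<inter> Z = {}" "Y \<inter> Z = {}"
    by (auto simp: X_def Y_def Z_def)
  ultimately show ?thesis by (simp add: num_desc_def card_Un_disjoint)
qed

lemma num_desc_single:
  assumes p: "is_partition p" and i: "1 \<le> i" "i < sum_list p"
  shows "num_desc p {i} = num_desc p {1}"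
  using i
proof (induction i rule: dec_induct)
  case (step i)
  then show ?case using num_desc_shift[OF p, of i "{}"] by simp
qed simp

text \<open>
  The smaller position is moved down to 1 before the larger one is moved down to 3. In this order
  the two stay at distance at least 2, which is what \<open>num_desc_shift\<close> requires.
\<close>

lemma num_desc_pair:
  assumes p: "is_partition p" and ij: "1 \<le> i" "i + 2 \<le> j" "j < sum_list p"
  shows "num_desc p {i, j} = num_desc p {1, 3}"
proof -
  have "num_desc p {i, j} = num_desc p {1, j}"
    using ij(1,2)
  proof (induction i rule: dec_induct)
    case (step i)
    then show ?case using num_desc_shift[OF p, of i "{j}"] ij(3) by simp
  qed simp
  also have "3 \<le> j" using ij by simp
  then have "num_desc p {1, j} = num_desc p {1, 3}"
    using ij(3)
  proof (induction j rule: dec_induct)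
    case (step j)
    then show ?case using num_desc_shift[OF p, of j "{1}"] by (simp add: insert_commute)
  qed simp
  finally show ?thesis .
qed

section \<open>The descent probability\<close>

definition cell_content :: "nat \<times> nat \<Rightarrow> real" where
  "cell_content x = real (snd x) - real (fst x)"

text \<open>
  Consecutive entries in a common row or column occupy neighbouring cells, so the content changes by
  exactly one: upwards along a row, where there is no descent, and downwards along a column, where
  there is one.
\<close>

lemma content_step_not_swappable:
  assumes p: "is_partition p" and T: "T \<in> SYT p" and i: "1 \<le> i" "i < sum_list p"
    and ns: "\<not> swappable p i T"
  shows "cell_content (cell_of p T (Suc i)) - cell_content (cell_of p T i)
    = (if i \<in> descents p T then -1 else 1)"
proof -
  let ?a = "row_of p T i" and ?b = "row_of p T (Suc i)"
  let ?x = "col_of p T i" and ?y = "col_of p T (Suc i)"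
  let ?A = "cell_of p T i" and ?B = "cell_of p T (Suc i)"
  have B: "?B \<in> diagram p" using cell_of_in_diagram[OF T, of "Suc i"] i by simp
  have no_between: False
    if "?a \<le> fst z" "fst z \<le> ?b" "?x \<le> snd z" "snd z \<le> ?y" "z \<noteq> ?A" "z \<noteq> ?B" for z
  proof -
    have d: "z \<in> diagram p" using diagram_down_closed[OF p B] that by simp
    have "T ?A < T z" using SYT_strict_mono[OF p T d] that by simp
    moreover have "T z < T ?B" using SYT_strict_mono[OF p T B] that by simp
    ultimately show False
      using entry_cell_of[OF T, of i] entry_cell_of[OF T, of "Suc i"] i by simp
  qed
  show ?thesis
  proof (cases "?a < ?b")
    case True
    then have "?x = ?y" using descent_col_le[OF p T i] ns by (auto simp: swappable_def)
    moreover have "?b = Suc ?a"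
      using no_between[of "(Suc ?a, ?x)"] True \<open>?x = ?y\<close> by (fastforce simp: prod_eq_iff)
    ultimately show ?thesis
      using True i by (simp add: cell_content_def mem_descents_iff[OF p T])
  next
    case False
    then have "?x < ?y" using nondescent_col_less[OF p T i] by simp
    then have "?a = ?b" using ns by (auto simp: swappable_def)
    moreover have "?y = Suc ?x"
      using no_between[of "(?a, Suc ?x)"] \<open>?x < ?y\<close> \<open>?a = ?b\<close> by (fastforce simp: prod_eq_iff)
    ultimately show ?thesis
      using False by (simp add: cell_content_def mem_descents_iff[OF p T])
  qed
qed

text \<open>
  Where the two entries can be exchanged, the exchange negates both the content difference and the
  descent sign, so these tableaux contribute zero to either side. On all others the two agree.
\<close>

lemma sum_content_step:
  assumes p: "is_partition p" and i: "1 \<le> i" "i < sum_list p"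
  shows "(\<Sum>T\<in>SYT p. cell_content (cell_of p T (Suc i)) - cell_content (cell_of p T i))
    = (\<Sum>T\<in>SYT p. if i \<in> descents p T then -1 else 1)"
proof -
  define g where "g T = cell_content (cell_of p T (Suc i)) - cell_content (cell_of p T i)
    - (if i \<in> descents p T then -1 else 1 :: real)" for T
  define \<phi> where "\<phi> T = (if swappable p i T then swap_entries p i T else T)" for T
  have \<phi>: "\<phi> T \<in> SYT p" "\<phi> (\<phi> T) = T" "g (\<phi> T) = - g T" if T: "T \<in> SYT p" for T
  proof -
    show S: "\<phi> T \<in> SYT p" using T i by (simp add: \<phi>_def swap_entries_SYT)
    show "\<phi> (\<phi> T) = T"
      using T i by (simp add: \<phi>_def swappable_swap_entries swap_entries_twice)
    show "g (\<phi> T) = - g T"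
    proof (cases "swappable p i T")
      case True
      then have "cell_of p (\<phi> T) i = cell_of p T (Suc i)"
        "cell_of p (\<phi> T) (Suc i) = cell_of p T i"
        using cell_of_swap_entries[OF T i True] i by (simp_all add: \<phi>_def)
      moreover from this True have "i \<in> descents p (\<phi> T) \<longleftrightarrow> i \<notin> descents p T"
        using i by (auto simp: mem_descents_iff[OF p S] mem_descents_iff[OF p T] swappable_def)
      ultimately show ?thesis by (simp add: g_def)
    next
      case False
      then show ?thesis
        using content_step_not_swappable[OF p T i] by (simp add: g_def \<phi>_def)
    qed
  qed
  have "(\<Sum>T\<in>SYT p. g T) = (\<Sum>T\<in>SYT p. - g T)"
    by (rule sum.reindex_bij_witness[where i = \<phi> and j = \<phi>]) (use \<phi> in auto)
  then have "(\<Sum>T\<in>SYT p. g T) = 0" by (simp add: sum_negf)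
  then show ?thesis by (simp add: g_def sum_subtractf)
qed

lemma sum_descent_sign:
  "(\<Sum>T\<in>SYT p. if i \<in> descents p T then -1 else 1) = real (card (SYT p)) - 2 * real (num_desc p {i})"
proof -
  have "(\<Sum>T\<in>SYT p. if i \<in> descents p T then -1 else 1)
    = (\<Sum>T\<in>SYT p. 1 - 2 * (if i \<in> descents p T then 1 else 0 :: real))"
    by (intro sum.cong) auto
  also have "\<dots> = real (card (SYT p)) - 2 * (\<Sum>T\<in>SYT p. if i \<in> descents p T then 1 else 0)"
    by (simp add: sum_subtractf sum_distrib_left)
  also have "(\<Sum>T\<in>SYT p. if i \<in> descents p T then 1 else 0) = real (num_desc p {i})"
    by (simp add: num_desc_def sum.If_cases finite_SYT Int_def)
  finally show ?thesis .
qed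

lemma cell_of_1:
  assumes p: "is_partition p" and T: "T \<in> SYT p" and n: "1 \<le> sum_list p"
  shows "cell_of p T 1 = (0, 0)"
proof (rule ccontr)
  assume ne: "cell_of p T 1 \<noteq> (0, 0)"
  have d: "cell_of p T 1 \<in> diagram p"
    using cell_of_in_diagram[OF T, of 1] n by simp
  have "T (0, 0) < T (cell_of p T 1)" using SYT_strict_mono[OF p T d, of "(0, 0)"] ne by auto
  moreover have "T (0, 0) \<in> {1..sum_list p}"
    using SYT_range[OF T] diagram_down_closed[OF p d, of "(0, 0)"] by simp
  ultimately show False using entry_cell_of[OF T, of 1] n by simp
qed

text \<open>
  The entry 1 sits in the corner, whose content is 0; each further step adds the same amount because
  descents are equidistributed.
\<close>

lemma sum_content_entry:
  assumes p: "is_partition p" and k: "1 \<le> k" "k \<le> sum_list p"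
  shows "(\<Sum>T\<in>SYT p. cell_content (cell_of p T k))
    = real (k - 1) * (real (card (SYT p)) - 2 * real (num_desc p {1}))"
  using k
proof (induction k rule: dec_induct)
  case base
  then show ?case using cell_of_1[OF p] by (simp add: cell_content_def)
next
  case (step k)
  have "(\<Sum>T\<in>SYT p. cell_content (cell_of p T (Suc k)))
    = (\<Sum>T\<in>SYT p. cell_content (cell_of p T k))
      + (\<Sum>T\<in>SYT p. cell_content (cell_of p T (Suc k)) - cell_content (cell_of p T k))"
    by (simp add: sum_subtractf)
  also have "\<dots> = real (k - 1) * (real (card (SYT p)) - 2 * real (num_desc p {1}))
      + (real (card (SYT p)) - 2 * real (num_desc p {1}))"
    using step sum_content_step[OF p, of k] sum_descent_sign[of k p] num_desc_single[OF p, of k]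
    by simp
  also have "\<dots> = real (Suc k - 1) * (real (card (SYT p)) - 2 * real (num_desc p {1}))"
    using step by (simp add: of_nat_diff algebra_simps)
  finally show ?case .
qed

text \<open>
  Summed over all entries, the contents of a tableau give the sum of the contents of its diagram. In
  the language of characters, this is the formula for the normalised character of a transposition.
\<close>

lemma content_sum_formula:
  assumes p: "is_partition p"
  shows "real (card (SYT p)) * (\<Sum>x\<in>diagram p. cell_content x)
    = real (sum_list p) * (real (sum_list p) - 1) / 2
      * (real (card (SYT p)) - 2 * real (num_desc p {1}))"
proof -
  let ?n = "sum_list p" and ?a = "real (card (SYT p)) - 2 * real (num_desc p {1})"
  have "(\<Sum>k=1..?n. cell_content (cell_of p T k)) = (\<Sum>x\<in>diagram p. cell_content x)" if T: "T \<in> SYT p" for T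
    by (rule sum.reindex_bij_witness[where i = T and j = "cell_of p T"])
      (use cell_of_entry[OF T] entry_cell_of[OF T] cell_of_in_diagram[OF T] SYT_range[OF T] in auto)
  then have "real (card (SYT p)) * (\<Sum>x\<in>diagram p. cell_content x)
    = (\<Sum>T\<in>SYT p. \<Sum>k=1..?n. cell_content (cell_of p T k))" by simp
  also have "\<dots> = (\<Sum>k=1..?n. \<Sum>T\<in>SYT p. cell_content (cell_of p T k))" by (rule sum.swap)
  also have "\<dots> = (\<Sum>k=1..?n. real (k - 1) * ?a)"
    using sum_content_entry[OF p] by simp
  also have "\<dots> = (\<Sum>k=1..?n. real (k - 1)) * ?a" by (simp add: sum_distrib_right)
  also have "(\<Sum>k=1..m. real (k - 1)) = real m * (real m - 1) / 2" for m
    by (induction m) (auto simp: field_simps)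
  finally show ?thesis .
qed

lemma part_le_hd:
  assumes "is_partition p" "r < length p"
  shows "p ! r \<le> hd p"
  using assms by (cases p; cases r) (auto simp: is_partition_def)

text \<open>
  The contents in a row of length \<open>l\<close> average to at most \<open>(l - 1) / 2\<close>, and no row is longer than
  the first one.
\<close>

lemma content_sum_le:
  assumes p: "is_partition p"
  shows "(\<Sum>x\<in>diagram p. cell_content x) \<le> real (sum_list p) * (real (hd p) - 1) / 2"
proof -
  have D: "diagram p = (SIGMA r:{..<length p}. {..<p ! r})" by (auto simp: diagram_def)
  have tri: "(\<Sum>c<m. real c) = real m * (real m - 1) / 2" for m
    by (induction m) (auto simp: field_simps)
  have "(\<Sum>x\<in>diagram p. cell_content x) \<le> (\<Sum>x\<in>diagram p. real (snd x))"
    by (intro sum_mono) (simp add: cell_content_def)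
  also have "\<dots> = (\<Sum>r<length p. \<Sum>c<p ! r. real c)"
    unfolding D by (subst sum.Sigma) (auto simp: case_prod_beta)
  also have "\<dots> \<le> (\<Sum>r<length p. real (p ! r) * ((real (hd p) - 1) / 2))"
  proof (intro sum_mono)
    fix r assume "r \<in> {..<length p}"
    then have "p ! r \<le> hd p" using part_le_hd[OF p] by simp
    then show "(\<Sum>c<p ! r. real c) \<le> real (p ! r) * ((real (hd p) - 1) / 2)"
      unfolding tri by (simp add: mult_left_mono)
  qed
  also have "\<dots> = (\<Sum>r<length p. real (p ! r)) * ((real (hd p) - 1) / 2)"
    by (simp only: sum_distrib_right)
  also have "\<dots> = real (sum_list p) * (real (hd p) - 1) / 2"
    by (simp add: sum_list_sum_nth atLeast0LessThan)
  finally show ?thesis .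
qed

lemma num_desc_lower:
  assumes p: "is_partition p" and n: "sum_list p \<ge> 1"
  shows "real (card (SYT p)) * (real (sum_list p) - real (hd p))
    \<le> 2 * (real (sum_list p) - 1) * real (num_desc p {1})"
proof -
  let ?n = "real (sum_list p)" and ?N = "real (card (SYT p))"
  have "?n * (?n - 1) / 2 * (?N - 2 * real (num_desc p {1})) \<le> ?N * (?n * (real (hd p) - 1) / 2)"
    unfolding content_sum_formula[OF p, symmetric]
    by (rule mult_left_mono[OF content_sum_le[OF p]]) simp
  then have "?n * ((?n - 1) * (?N - 2 * real (num_desc p {1}))) \<le> ?n * (?N * (real (hd p) - 1))"
    by (simp add: field_simps)
  then have "(?n - 1) * (?N - 2 * real (num_desc p {1})) \<le> ?N * (real (hd p) - 1)"
    using n by simp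
  then show ?thesis by (simp add: algebra_simps)
qed

section \<open>Moments of descent functions\<close>

lemma sum_SYT_linear:
  assumes p: "is_partition p"
  shows "(\<Sum>T\<in>SYT p. \<Sum>i\<in>descents p T. f i) = real (num_desc p {1}) * (\<Sum>i=1..<sum_list p. f i)"
proof -
  have "(\<Sum>T\<in>SYT p. \<Sum>i\<in>descents p T. f i)
    = (\<Sum>T\<in>SYT p. \<Sum>i=1..<sum_list p. if i \<in> descents p T then f i else 0)"
  proof (rule sum.cong)
    fix T assume "T \<in> SYT p"
    from descents_subset[OF p this]
    show "(\<Sum>i\<in>descents p T. f i) = (\<Sum>i=1..<sum_list p. if i \<in> descents p T then f i else 0)"
      by (simp add: sum.If_cases Int_absorb1)
  qed simp
  also have "\<dots> = (\<Sum>i=1..<sum_list p. \<Sum>T\<in>SYT p. if i \<in> descents p T then f i else 0)"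
    by (rule sum.swap)
  also have "\<dots> = (\<Sum>i=1..<sum_list p. f i * real (num_desc p {i}))"
    by (simp add: num_desc_def sum.If_cases finite_SYT Int_def mult.commute)
  also have "\<dots> = (\<Sum>i=1..<sum_list p. f i * real (num_desc p {1}))"
  proof (rule sum.cong)
    fix i assume "i \<in> {1..<sum_list p}"
    then show "f i * real (num_desc p {i}) = f i * real (num_desc p {1})"
      using num_desc_single[OF p, of i] by simp
  qed simp
  also have "\<dots> = real (num_desc p {1}) * (\<Sum>i=1..<sum_list p. f i)"
    by (simp only: sum_distrib_right mult.commute)
  finally show ?thesis .
qed

lemma sum_SYT_square:
  assumes p: "is_partition p"
  shows "(\<Sum>T\<in>SYT p. (\<Sum>i\<in>descents p T. f i)\<^sup>2)
    = (\<Sum>i=1..<sum_list p. \<Sum>j=1..<sum_list p. f i * f j * real (num_desc p {i, j}))"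
proof -
  let ?I = "{1..<sum_list p}"
  have "(\<Sum>T\<in>SYT p. (\<Sum>i\<in>descents p T. f i)\<^sup>2)
    = (\<Sum>T\<in>SYT p. \<Sum>i\<in>?I. \<Sum>j\<in>?I. if {i, j} \<subseteq> descents p T then f i * f j else 0)"
  proof (rule sum.cong)
    fix T assume T: "T \<in> SYT p"
    have "(\<Sum>i\<in>descents p T. f i) = (\<Sum>i\<in>?I. if i \<in> descents p T then f i else 0)"
      using descents_subset[OF p T] by (simp add: sum.If_cases Int_absorb1)
    then show "(\<Sum>i\<in>descents p T. f i)\<^sup>2
      = (\<Sum>i\<in>?I. \<Sum>j\<in>?I. if {i, j} \<subseteq> descents p T then f i * f j else 0)"
      by (auto simp: power2_eq_square sum_product intro!: sum.cong)
  qed simp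
  also have "\<dots> = (\<Sum>i\<in>?I. \<Sum>j\<in>?I. \<Sum>T\<in>SYT p. if {i, j} \<subseteq> descents p T then f i * f j else 0)"
    by (subst sum.swap, rule sum.cong[OF refl], rule sum.swap)
  also have "\<dots> = (\<Sum>i\<in>?I. \<Sum>j\<in>?I. f i * f j * real (num_desc p {i, j}))"
    by (simp add: num_desc_def sum.If_cases finite_SYT Int_def mult.commute)
  finally show ?thesis .
qed

text \<open>
  If \<open>i\<close> is a descent, then \<open>i + 1\<close> lies below the first row; so the successors of descents and the
  entries of the first row are disjoint sets of entries.
\<close>

lemma card_descents_le:
  assumes p: "is_partition p" and T: "T \<in> SYT p" and n: "p \<noteq> []"
  shows "card (descents p T) + hd p \<le> sum_list p"
proof -
  let ?R = "(\<lambda>c. (0, c)) ` {..<hd p}"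
  have R: "?R \<subseteq> diagram p" using n by (auto simp: diagram_def hd_conv_nth)
  have inj: "inj_on T (diagram p)" using SYT_bij[OF T] by (simp add: bij_betw_def)
  have "card (T ` ?R) = hd p"
    using card_image[OF inj_on_subset[OF inj R]] by (simp add: card_image inj_on_def)
  moreover have "card (Suc ` descents p T) = card (descents p T)" by (simp add: card_image)
  moreover have "T ` ?R \<inter> Suc ` descents p T = {}"
  proof (rule ccontr)
    assume "T ` ?R \<inter> Suc ` descents p T \<noteq> {}"
    then obtain c i where c: "c < hd p" "i \<in> descents p T" "T (0, c) = Suc i" by auto
    then have "cell_of p T (Suc i) = (0, c)" using cell_of_entry[OF T, of "(0, c)"] R by auto
    then show False using c(2) by (simp add: mem_descents_iff[OF p T])
  qed
  moreover have "T ` ?R \<union> Suc ` descents p T \<subseteq> {1..sum_list p}"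
    using R SYT_range[OF T] descents_subset[OF p T] by auto
  moreover have "finite (descents p T)" using descents_subset[OF p T] finite_subset by blast
  ultimately show ?thesis
    using card_mono[of "{1..sum_list p}" "T ` ?R \<union> Suc ` descents p T"]
    by (simp add: card_Un_disjoint)
qed

lemma num_desc_upper:
  assumes p: "is_partition p" and n: "p \<noteq> []"
  shows "(real (sum_list p) - 1) * real (num_desc p {1})
    \<le> real (card (SYT p)) * (real (sum_list p) - real (hd p))"
proof -
  have "real (sum_list p - 1) * real (num_desc p {1}) = (\<Sum>T\<in>SYT p. real (card (descents p T)))"
    using sum_SYT_linear[OF p, of "\<lambda>_. 1"] by (simp add: mult.commute)
  also have "\<dots> \<le> (\<Sum>T\<in>SYT p. real (sum_list p) - real (hd p))"
  proof (rule sum_mono)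
    fix T assume "T \<in> SYT p"
    from card_descents_le[OF p this n]
    show "real (card (descents p T)) \<le> real (sum_list p) - real (hd p)" by linarith
  qed
  finally have "real (sum_list p - 1) * real (num_desc p {1})
    \<le> real (card (SYT p)) * (real (sum_list p) - real (hd p))" by simp
  moreover have "(real (sum_list p) - 1) * real (num_desc p {1}) \<le> real (sum_list p - 1) * real (num_desc p {1})"
    by (rule mult_right_mono) auto
  ultimately show ?thesis by linarith
qed

lemma num_desc_far:
  assumes p: "is_partition p" and ij: "i \<in> {1..<sum_list p}" "j \<in> {1..<sum_list p}" "j \<notin> {i-1..i+1}"
  shows "num_desc p {i, j} = num_desc p {1, 3}"
proof (cases "i < j")
  case True
  then show ?thesis using ij num_desc_pair[OF p, of i j] by auto
next
  case False
  then show ?thesis using ij num_desc_pair[OF p, of j i] by (auto simp: insert_commute)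
qed

text \<open>
  A count of the ordered pairs of descents at distance at least 2. For each position at most three others
  (itself included) are closer, which leaves at least \<open>n - 4\<close> partners; and a tableau has at most
  \<open>(n - hd p)\<^sup>2\<close> ordered pairs of descents.
\<close>

lemma num_desc_13_upper:
  assumes p: "is_partition p" and n: "p \<noteq> []"
  shows "(real (sum_list p) - 1) * (real (sum_list p) - 4) * real (num_desc p {1, 3})
    \<le> real (card (SYT p)) * (real (sum_list p) - real (hd p))\<^sup>2"
proof -
  let ?I = "{1..<sum_list p}" and ?q = "real (num_desc p {1, 3})"
  have "sum_list p \<ge> 1"
    using p n by (cases p) (auto simp: is_partition_def)
  then have len: "real (sum_list p) - 1 = real (card ?I)" by simp
  have "(real (sum_list p) - 1) * (real (sum_list p) - 4) * ?q
    = (\<Sum>i\<in>?I. (real (sum_list p) - 4) * ?q)" by (simp add: len)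
  also have "\<dots> \<le> (\<Sum>i\<in>?I. \<Sum>j\<in>?I. real (num_desc p {i, j}))"
  proof (rule sum_mono)
    fix i assume i: "i \<in> ?I"
    have "card ?I - card {i-1..i+1} \<le> card (?I - {i-1..i+1})"
      by (rule diff_card_le_card_Diff) simp
    moreover have "card {i-1..i+1} \<le> 3" by simp
    ultimately have "real (sum_list p) - 4 \<le> real (card (?I - {i-1..i+1}))"
      by simp
    then have "(real (sum_list p) - 4) * ?q \<le> real (card (?I - {i-1..i+1})) * ?q"
      by (rule mult_right_mono) simp
    also have "\<dots> = (\<Sum>j\<in>?I - {i-1..i+1}. real (num_desc p {i, j}))"
      using num_desc_far[OF p i] by simp
    also have "\<dots> \<le> (\<Sum>j\<in>?I. real (num_desc p {i, j}))"
      by (rule sum_mono2) auto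
    finally show "(real (sum_list p) - 4) * ?q \<le> (\<Sum>j\<in>?I. real (num_desc p {i, j}))" .
  qed
  also have "\<dots> = (\<Sum>T\<in>SYT p. (real (card (descents p T)))\<^sup>2)"
    using sum_SYT_square[OF p, of "\<lambda>_. 1"] by simp
  also have "\<dots> \<le> (\<Sum>T\<in>SYT p. (real (sum_list p) - real (hd p))\<^sup>2)"
  proof (rule sum_mono)
    fix T assume "T \<in> SYT p"
    from card_descents_le[OF p this n]
    have "real (card (descents p T)) \<le> real (sum_list p) - real (hd p)" by linarith
    then show "(real (card (descents p T)))\<^sup>2 \<le> (real (sum_list p) - real (hd p))\<^sup>2"
      by (rule power_mono) simp
  qed
  finally show ?thesis by simp
qed

lemma num_desc_mono: "S \<subseteq> S' \<Longrightarrow> num_desc p S' \<le> num_desc p S"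
  unfolding num_desc_def using finite_SYT by (intro card_mono) auto

text \<open>
  For a large partition the factor \<open>n - 4\<close> in \<open>num_desc_13_upper\<close> is comparable to \<open>n - 1\<close>, and the
  lower bound on single descents applies. For at most six cells that factor may vanish or be negative;
  but then the probability of a single descent is at least 1/10, and two descents are no more likely
  than one.
\<close>

lemma num_desc_pair_le:
  assumes p: "is_partition p" and n: "p \<noteq> []" and k: "hd p < sum_list p"
  shows "real (num_desc p {1, 3}) * real (card (SYT p)) \<le> 10 * (real (num_desc p {1}))\<^sup>2"
proof -
  define n where "n = real (sum_list p)"
  define k where "k = real (sum_list p) - real (hd p)"
  define N where "N = real (card (SYT p))"
  define b where "b = real (num_desc p {1})"
  define q where "q = real (num_desc p {1, 3})"
  have "hd p \<ge> 1" using p n by (cases p) (auto simp: is_partition_def)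
  then have k1: "1 \<le> k" and n2: "2 \<le> n" using k unfolding k_def n_def by linarith+
  have pos: "0 \<le> N" "0 \<le> b" "0 \<le> q" by (simp_all add: N_def b_def q_def)
  have lower: "N * k \<le> 2 * (n - 1) * b"
    using num_desc_lower[OF p] k by (simp add: N_def k_def n_def b_def)
  have qb: "q \<le> b" unfolding q_def b_def using num_desc_mono[of "{1}" "{1, 3}" p] by simp
  have "q * N \<le> 10 * b\<^sup>2"
  proof (cases "sum_list p \<le> 6")
    case True
    then have "n - 1 \<le> 5" by (simp add: n_def)
    have "N * 1 \<le> N * k" using k1 pos by (intro mult_left_mono)
    also have "\<dots> \<le> 2 * (n - 1) * b" by (rule lower)
    also have "\<dots> \<le> 10 * b" using \<open>n - 1 \<le> 5\<close> pos by (intro mult_right_mono) auto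
    finally have "q * N \<le> b * (10 * b)" using qb pos by (intro mult_mono) auto
    then show ?thesis by (simp add: power2_eq_square)
  next
    case False
    then have n7: "7 \<le> n" by (simp add: n_def)
    have "(n - 1) * (n - 4) * q \<le> N * k\<^sup>2"
      using num_desc_13_upper[OF p n] by (simp add: n_def q_def N_def k_def)
    moreover have "(n - 1)\<^sup>2 * q \<le> 2 * ((n - 1) * (n - 4) * q)"
    proof -
      have "(n - 1) * (n - 1) \<le> (n - 1) * (2 * (n - 4))"
        using n7 by (intro mult_left_mono) auto
      from mult_right_mono[OF this pos(3)] show ?thesis
        by (simp add: power2_eq_square algebra_simps)
    qed
    ultimately have "(n - 1)\<^sup>2 * q \<le> 2 * (N * k\<^sup>2)" by linarith
    then have "(n - 1)\<^sup>2 * q * N \<le> 2 * (N * k\<^sup>2) * N" using pos by (intro mult_right_mono)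
    also have "\<dots> = 2 * (N * k)\<^sup>2" by (simp add: power2_eq_square)
    also have "(N * k)\<^sup>2 \<le> (2 * (n - 1) * b)\<^sup>2" using lower pos k1 by (intro power_mono) auto
    also have "2 * (2 * (n - 1) * b)\<^sup>2 = (n - 1)\<^sup>2 * (8 * b\<^sup>2)"
      by (simp add: power2_eq_square algebra_simps)
    finally have "(n - 1)\<^sup>2 * (q * N) \<le> (n - 1)\<^sup>2 * (8 * b\<^sup>2)" by (simp add: mult.assoc)
    then have "q * N \<le> 8 * b\<^sup>2" using n7 by (subst (asm) mult_le_cancel_left_pos) auto
    also have "\<dots> \<le> 10 * b\<^sup>2" by simp
    finally show ?thesis .
  qed
  then show ?thesis by (simp add: q_def N_def b_def)
qed

lemma second_moment_lower:
  assumes p: "is_partition p" and f: "\<And>i. i \<ge> 1 \<Longrightarrow> f i \<ge> 0"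
  shows "real (num_desc p {1}) * (\<Sum>i=1..<sum_list p. (f i)\<^sup>2) \<le> (\<Sum>T\<in>SYT p. (descent_fun f p T)\<^sup>2)"
proof -
  let ?I = "{1..<sum_list p}"
  have "real (num_desc p {1}) * (\<Sum>i\<in>?I. (f i)\<^sup>2) = (\<Sum>i\<in>?I. f i * f i * real (num_desc p {i, i}))"
    unfolding sum_distrib_left
  proof (rule sum.cong)
    fix i assume "i \<in> ?I"
    then show "real (num_desc p {1}) * (f i)\<^sup>2 = f i * f i * real (num_desc p {i, i})"
      using num_desc_single[OF p, of i] by (simp add: power2_eq_square)
  qed simp
  also have "\<dots> \<le> (\<Sum>i\<in>?I. \<Sum>j\<in>?I. f i * f j * real (num_desc p {i, j}))"
    using f by (intro sum_mono member_le_sum) auto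
  finally show ?thesis by (simp only: sum_SYT_square[OF p] descent_fun_def)
qed

lemma second_moment_upper:
  assumes p: "is_partition p" and f: "\<And>i. i \<ge> 1 \<Longrightarrow> f i \<ge> 0"
  shows "(\<Sum>T\<in>SYT p. (descent_fun f p T)\<^sup>2)
    \<le> 3 * real (num_desc p {1}) * (\<Sum>i=1..<sum_list p. (f i)\<^sup>2)
      + real (num_desc p {1, 3}) * (\<Sum>i=1..<sum_list p. f i)\<^sup>2"
proof -
  let ?I = "{1..<sum_list p}"
  define b where "b = real (num_desc p {1})"
  define q where "q = real (num_desc p {1, 3})"
  define near :: "nat \<Rightarrow> nat \<Rightarrow> real" where "near i j = (if j \<in> {i-1..i+1} then 1 else 0)" for i j
  \<comment> \<open>Close pairs are bounded by \<open>2 x y \<le> x\<^sup>2 + y\<^sup>2\<close>, each index having at most three close partners.\<close>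
  have near_sym: "near i j = near j i" for i j by (auto simp: near_def)
  have pos: "0 \<le> b" "0 \<le> q" by (simp_all add: b_def q_def)
  have pair_bound: "f i * f j * real (num_desc p {i, j})
    \<le> b / 2 * (near i j * (f i)\<^sup>2) + b / 2 * (near j i * (f j)\<^sup>2) + q * (f i * f j)"
    if ij: "i \<in> ?I" "j \<in> ?I" for i j
  proof (cases "j \<in> {i-1..i+1}")
    case True
    have "num_desc p {i, j} \<le> num_desc p {i}" by (rule num_desc_mono) simp
    then have "real (num_desc p {i, j}) \<le> b" using num_desc_single[OF p, of i] ij by (simp add: b_def)
    then have "f i * f j * real (num_desc p {i, j}) \<le> f i * f j * b"
      using f ij by (intro mult_left_mono) auto
    also have "\<dots> \<le> ((f i)\<^sup>2 + (f j)\<^sup>2) / 2 * b"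
      using sum_squares_bound[of "f i" "f j"] pos by (intro mult_right_mono) auto
    also have "\<dots> = b / 2 * (near i j * (f i)\<^sup>2) + b / 2 * (near j i * (f j)\<^sup>2)"
      using True near_sym[of j i] by (simp add: near_def field_simps)
    finally show ?thesis using f ij pos by (simp add: add_increasing2)
  next
    case False
    then show ?thesis
      using num_desc_far[OF p ij False] pos by (simp add: near_def q_def)
  qed
  have diag: "(\<Sum>i\<in>?I. \<Sum>j\<in>?I. near i j * (f i)\<^sup>2) \<le> 3 * (\<Sum>i\<in>?I. (f i)\<^sup>2)"
    unfolding sum_distrib_left
  proof (rule sum_mono)
    fix i assume "i \<in> ?I"
    have "(\<Sum>j\<in>?I. near i j) = real (card (?I \<inter> {i-1..i+1}))"
      by (simp add: near_def sum.If_cases del: atLeastAtMost_iff)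
    also have "\<dots> \<le> real (card {i-1..i+1})" by (intro of_nat_mono card_mono) auto
    also have "\<dots> \<le> 3" by simp
    finally have "(\<Sum>j\<in>?I. near i j) * (f i)\<^sup>2 \<le> 3 * (f i)\<^sup>2" by (rule mult_right_mono) simp
    then show "(\<Sum>j\<in>?I. near i j * (f i)\<^sup>2) \<le> 3 * (f i)\<^sup>2" by (simp add: sum_distrib_right)
  qed
  have "(\<Sum>T\<in>SYT p. (descent_fun f p T)\<^sup>2)
      = (\<Sum>i\<in>?I. \<Sum>j\<in>?I. f i * f j * real (num_desc p {i, j}))"
    by (simp only: sum_SYT_square[OF p] descent_fun_def)
  also have "\<dots> \<le> (\<Sum>i\<in>?I. \<Sum>j\<in>?I. b / 2 * (near i j * (f i)\<^sup>2)
      + b / 2 * (near j i * (f j)\<^sup>2) + q * (f i * f j))"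
    by (intro sum_mono pair_bound)
  also have "\<dots> = b / 2 * (\<Sum>i\<in>?I. \<Sum>j\<in>?I. near i j * (f i)\<^sup>2)
      + b / 2 * (\<Sum>i\<in>?I. \<Sum>j\<in>?I. near j i * (f j)\<^sup>2) + q * (\<Sum>i\<in>?I. \<Sum>j\<in>?I. f i * f j)"
    by (simp only: sum.distrib sum_distrib_left)
  also have "(\<Sum>i\<in>?I. \<Sum>j\<in>?I. near j i * (f j)\<^sup>2) = (\<Sum>i\<in>?I. \<Sum>j\<in>?I. near i j * (f i)\<^sup>2)"
    by (rule sum.swap)
  also have "(\<Sum>i\<in>?I. \<Sum>j\<in>?I. f i * f j) = (\<Sum>i\<in>?I. f i)\<^sup>2"
    by (simp only: power2_eq_square sum_product)
  also have "b / 2 * (\<Sum>i\<in>?I. \<Sum>j\<in>?I. near i j * (f i)\<^sup>2)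
      + b / 2 * (\<Sum>i\<in>?I. \<Sum>j\<in>?I. near i j * (f i)\<^sup>2) + q * (\<Sum>i\<in>?I. f i)\<^sup>2
    = b * (\<Sum>i\<in>?I. \<Sum>j\<in>?I. near i j * (f i)\<^sup>2) + q * (\<Sum>i\<in>?I. f i)\<^sup>2"
    by simp
  also have "\<dots> \<le> b * (3 * (\<Sum>i\<in>?I. (f i)\<^sup>2)) + q * (\<Sum>i\<in>?I. f i)\<^sup>2"
    using mult_left_mono[OF diag pos(1)] by simp
  finally show ?thesis by (simp add: b_def q_def mult.assoc mult.left_commute)
qed

section \<open>Variance against squared expectation\<close>

lemma E_desc_eq:
  assumes p: "is_partition p"
  shows "E_desc p f = real (num_desc p {1}) / real (card (SYT p)) * (\<Sum>i=1..<sum_list p. f i)"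
proof -
  have "(\<Sum>T\<in>SYT p. descent_fun f p T) = real (num_desc p {1}) * (\<Sum>i=1..<sum_list p. f i)"
    by (simp only: descent_fun_def sum_SYT_linear[OF p])
  then show ?thesis
    by (simp add: E_desc_def integral_pmf_of_set[OF SYT_nonempty finite_SYT])
qed

lemma V_desc_eq:
  "V_desc p f = (\<Sum>T\<in>SYT p. (descent_fun f p T)\<^sup>2) / real (card (SYT p)) - (E_desc p f)\<^sup>2"
proof -
  have int: "integrable (measure_pmf (pmf_of_set (SYT p))) g" for g :: "_ \<Rightarrow> real"
    by (rule integrable_measure_pmf_finite) (simp add: set_pmf_of_set[OF SYT_nonempty finite_SYT] finite_SYT)
  show ?thesis
    unfolding V_desc_def E_desc_def
    by (subst measure_pmf.variance_eq[OF int int])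
      (simp add: integral_pmf_of_set[OF SYT_nonempty finite_SYT])
qed

text \<open>
  Quantitative forms, for a single partition, of the two implications of the theorem. The numerical
  constants depend on neither \<open>p\<close> nor \<open>f\<close>, so that a bound for a whole sequence of partitions on
  one side turns into such a bound on the other.
\<close>

lemma variance_ratio_bounds:
  assumes p: "is_partition p" and f: "\<And>i. i \<ge> 1 \<Longrightarrow> f i > 0" and E: "E_desc p f \<noteq> 0"
  defines "n \<equiv> real (sum_list p)" and "k \<equiv> real (sum_list p) - real (hd p)"
    and "F \<equiv> (\<Sum>i=1..<sum_list p. f i)" and "Q \<equiv> (\<Sum>i=1..<sum_list p. (f i)\<^sup>2)"
    and "\<rho> \<equiv> V_desc p f / (E_desc p f)\<^sup>2"
  shows "0 \<le> \<rho>"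
    and "n * Q \<le> 2 * (1 + \<rho>) * k * F\<^sup>2"
    and "n * Q \<le> c * k * F\<^sup>2 \<Longrightarrow> \<rho> \<le> 6 * \<bar>c\<bar> + 10"
proof -
  define N where "N = real (card (SYT p))"
  define P where "P = real (num_desc p {1}) / N"
  define M where "M = (\<Sum>T\<in>SYT p. (descent_fun f p T)\<^sup>2) / N"
  have N: "N > 0" using SYT_nonempty finite_SYT by (simp add: N_def card_gt_0_iff)
  have EPF: "E_desc p f = P * F" by (simp add: E_desc_eq[OF p] P_def N_def F_def)
  have "P \<noteq> 0" "F \<noteq> 0" using E EPF by auto
  then have P: "P > 0" using N by (simp add: P_def)
  have n2: "sum_list p \<ge> 2"
  proof (rule ccontr)
    assume "\<not> ?thesis"
    then have "F = 0" by (simp add: F_def)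
    then show False using \<open>F \<noteq> 0\<close> by simp
  qed
  then have ne: "p \<noteq> []" by auto
  have F2: "F\<^sup>2 > 0" using \<open>F \<noteq> 0\<close> by simp
  have f0: "\<And>i. i \<ge> 1 \<Longrightarrow> f i \<ge> 0" using f less_imp_le by blast
  have upper: "(n - 1) * P \<le> k"
    using num_desc_upper[OF p ne] N by (simp add: P_def N_def n_def k_def field_simps)
  have lower: "k \<le> 2 * (n - 1) * P"
    using num_desc_lower[OF p] n2 N by (simp add: P_def N_def n_def k_def field_simps)
  have k: "k > 0"
  proof -
    have "0 < (n - 1) * P" using n2 P by (simp add: n_def)
    then show ?thesis using upper by linarith
  qed
  have M_lower: "P * Q \<le> M"
    using divide_right_mono[where c = N, OF second_moment_lower[OF p, of f, OF f0]] N by (simp add: P_def M_def Q_def)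
  have M_upper: "M \<le> 3 * P * Q + 10 * P\<^sup>2 * F\<^sup>2"
  proof -
    have "real (num_desc p {1, 3}) * N \<le> 10 * (real (num_desc p {1}))\<^sup>2"
      using num_desc_pair_le[OF p ne] k by (simp add: N_def k_def)
    then have "real (num_desc p {1, 3}) / N \<le> 10 * P\<^sup>2"
      using N by (simp add: P_def field_simps power2_eq_square)
    from mult_right_mono[OF this, of "F\<^sup>2"]
    have "real (num_desc p {1, 3}) / N * F\<^sup>2 \<le> 10 * P\<^sup>2 * F\<^sup>2" by simp
    moreover have "M \<le> 3 * P * Q + real (num_desc p {1, 3}) / N * F\<^sup>2"
      using divide_right_mono[where c = N, OF second_moment_upper[OF p, of f, OF f0]] N
      by (simp add: P_def M_def Q_def F_def add_divide_distrib)
    ultimately show ?thesis by linarith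
  qed
  have PF2: "P\<^sup>2 * F\<^sup>2 > 0" using P F2 by simp
  have rho: "\<rho> = M / (P\<^sup>2 * F\<^sup>2) - 1"
    using P \<open>F \<noteq> 0\<close> by (simp add: \<rho>_def V_desc_eq EPF M_def N_def power_mult_distrib diff_divide_distrib)
  have "V_desc p f \<ge> 0" unfolding V_desc_def by (rule integral_nonneg_AE) simp
  then show rho0: "0 \<le> \<rho>" by (simp add: \<rho>_def)
  have M_eq: "M = (1 + \<rho>) * (P\<^sup>2 * F\<^sup>2)" using rho P \<open>F \<noteq> 0\<close> by simp
  show "n * Q \<le> 2 * (1 + \<rho>) * k * F\<^sup>2"
  proof -
    have "P * Q \<le> P * ((1 + \<rho>) * P * F\<^sup>2)" using M_lower M_eq by (simp add: power2_eq_square ac_simps)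
    then have "Q \<le> (1 + \<rho>) * P * F\<^sup>2" using P by simp
    then have "n * Q \<le> n * ((1 + \<rho>) * P * F\<^sup>2)" by (rule mult_left_mono) (simp add: n_def)
    also have "\<dots> \<le> (2 * (n - 1)) * ((1 + \<rho>) * P * F\<^sup>2)"
      using n2 rho0 P by (intro mult_right_mono) (auto simp: n_def)
    also have "\<dots> = 2 * (1 + \<rho>) * F\<^sup>2 * ((n - 1) * P)" by (simp add: algebra_simps)
    also have "\<dots> \<le> 2 * (1 + \<rho>) * F\<^sup>2 * k" using upper rho0 by (intro mult_left_mono) auto
    finally show ?thesis by (simp add: ac_simps)
  qed
  show "\<rho> \<le> 6 * \<bar>c\<bar> + 10" if c: "n * Q \<le> c * k * F\<^sup>2"
  proof -
    have "n * Q \<le> c * (k * F\<^sup>2)" using c by (simp only: mult.assoc)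
    also have "\<dots> \<le> \<bar>c\<bar> * (k * F\<^sup>2)"
      by (rule mult_right_mono[OF abs_ge_self]) (use k in simp)
    also have "\<dots> \<le> \<bar>c\<bar> * (2 * n * P * F\<^sup>2)"
    proof -
      have "k \<le> 2 * n * P" using lower P by (simp add: algebra_simps)
      then show ?thesis by (intro mult_left_mono mult_right_mono) auto
    qed
    also have "\<dots> = n * (2 * \<bar>c\<bar> * P * F\<^sup>2)" by simp
    finally have "Q \<le> 2 * \<bar>c\<bar> * P * F\<^sup>2" using n2 by (simp add: n_def)
    then have "3 * P * Q \<le> 3 * P * (2 * \<bar>c\<bar> * P * F\<^sup>2)" using P by (intro mult_left_mono) auto
    also have "\<dots> = 6 * \<bar>c\<bar> * (P\<^sup>2 * F\<^sup>2)" by (simp add: power2_eq_square)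
    finally have "M \<le> (6 * \<bar>c\<bar> + 10) * (P\<^sup>2 * F\<^sup>2)" using M_upper by (simp add: algebra_simps)
    then have "(1 + \<rho>) * (P\<^sup>2 * F\<^sup>2) \<le> (6 * \<bar>c\<bar> + 10) * (P\<^sup>2 * F\<^sup>2)" by (simp only: M_eq)
    then have "1 + \<rho> \<le> 6 * \<bar>c\<bar> + 10" using PF2 by (rule mult_right_le_imp_le)
    then show ?thesis by simp
  qed
qed

theorem theorem2p3:
  fixes f :: "nat \<Rightarrow> real" and lam :: "nat \<Rightarrow> nat list"
  assumes f_pos: "\<And>i. i \<ge> 1 \<Longrightarrow> f i > 0"
    and partition: "\<And>m. m \<ge> 1 \<Longrightarrow> is_partition (lam m)"
    and ratio_defined: "\<And>m. m \<ge> 1 \<Longrightarrow> E_desc (lam m) f \<noteq> 0"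
  shows "bounded ((\<lambda>m. V_desc (lam m) f / (E_desc (lam m) f)\<^sup>2) ` {1..}) \<longleftrightarrow>
    (\<exists>c::real. \<forall>m\<ge>1. let n = sum_list (lam m) in
       real n * (\<Sum>i=1..n-1. (f i)\<^sup>2)
         \<le> c * (real n - real (hd (lam m))) * (\<Sum>i=1..n-1. f i)\<^sup>2)"
proof -
  have I: "{1..n - 1} = {1..<n}" for n :: nat
    by (cases n) (simp_all add: atLeastLessThanSuc_atLeastAtMost)
  let ?\<rho> = "\<lambda>m. V_desc (lam m) f / (E_desc (lam m) f)\<^sup>2"
  let ?k = "\<lambda>m. real (sum_list (lam m)) - real (hd (lam m))"
  show ?thesis unfolding Let_def I
  proof
    assume "bounded (?\<rho> ` {1..})"
    then obtain C where bound: "\<forall>x\<in>?\<rho> ` {1..}. \<bar>x\<bar> \<le> C"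
      unfolding bounded_real by blast
    have C: "?\<rho> m \<le> C" if "m \<ge> 1" for m
    proof (rule abs_le_D1[OF bspec[OF bound]])
      show "?\<rho> m \<in> ?\<rho> ` {1..}" using that by (intro imageI) simp
    qed
    have "real (sum_list (lam m)) * (\<Sum>i=1..<sum_list (lam m). (f i)\<^sup>2)
      \<le> 2 * (1 + C) * ?k m * (\<Sum>i=1..<sum_list (lam m). f i)\<^sup>2" if m: "m \<ge> 1" for m
    proof -
      \<comment> \<open>The empty partition, whose head is unspecified, has expectation 0 and is thus excluded.\<close>
      have k0: "0 \<le> ?k m"
      proof (cases "lam m")
        case Nil
        then have "E_desc (lam m) f = 0" using E_desc_eq[OF partition[OF m], of f] by simp
        then show ?thesis using ratio_defined[OF m] by simp
      qed simp
      have "real (sum_list (lam m)) * (\<Sum>i=1..<sum_list (lam m). (f i)\<^sup>2)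
        \<le> 2 * (1 + ?\<rho> m) * ?k m * (\<Sum>i=1..<sum_list (lam m). f i)\<^sup>2"
        using variance_ratio_bounds(2)[of "lam m" f, OF partition[OF m] f_pos ratio_defined[OF m]] by simp
      also have "\<dots> \<le> 2 * (1 + C) * ?k m * (\<Sum>i=1..<sum_list (lam m). f i)\<^sup>2"
        using C[OF m] k0 by (intro mult_right_mono) auto
      finally show ?thesis .
    qed
    then show "\<exists>c. \<forall>m\<ge>1. real (sum_list (lam m)) * (\<Sum>i=1..<sum_list (lam m). (f i)\<^sup>2)
      \<le> c * ?k m * (\<Sum>i=1..<sum_list (lam m). f i)\<^sup>2" by blast
  next
    assume "\<exists>c. \<forall>m\<ge>1. real (sum_list (lam m)) * (\<Sum>i=1..<sum_list (lam m). (f i)\<^sup>2)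
      \<le> c * ?k m * (\<Sum>i=1..<sum_list (lam m). f i)\<^sup>2"
    then obtain c where c: "\<And>m. m \<ge> 1 \<Longrightarrow> real (sum_list (lam m)) * (\<Sum>i=1..<sum_list (lam m). (f i)\<^sup>2)
      \<le> c * ?k m * (\<Sum>i=1..<sum_list (lam m). f i)\<^sup>2" by blast
    have "\<bar>?\<rho> m\<bar> \<le> 6 * \<bar>c\<bar> + 10" if m: "m \<ge> 1" for m
      using variance_ratio_bounds(1)[of "lam m" f, OF partition[OF m] f_pos ratio_defined[OF m]]
        variance_ratio_bounds(3)[of "lam m" f, OF partition[OF m] f_pos ratio_defined[OF m] c[OF m]] by simp
    then show "bounded (?\<rho> ` {1..})" unfolding bounded_real by auto
  qed
qed

end
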